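(* For every $p\in(0,1]$ and every integer $r\ge1$, the limit $\lim_{n\to\infty}\frac{\beta_r(G_{n,p})}{n}$ exists.
   Context: For $p\in[0,1]$ and $n\ge1$, $PC(G_{n,p},x)=\sum_{k=0}^{n}(-1)^k\binom nk p^{\binom k2}x^{n-k}$ (with $p^0=1$); for $p\in(0,1]$ all its roots are real. For $n\ge r$, $\beta_r(G_{n,p})$ denotes the $r$-th largest root of $PC(G_{n,p},x)$ (counted with multiplicity). *)

theory Defs
  imports "HOL-Analysis.Analysis" "HOL-Computational_Algebra.Polynomial"
begin

definition PC :: "nat \<Rightarrow> real \<Rightarrow> real poly" where
  "PC n p = (\<Sum>k=0..n. monom ((-1) ^ k * real (n choose k) * p ^ (k choose 2)) (n - k))"

(* r-th largest root for r >= 1, i.e. position r - 1 in the decreasing list of the real roots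
   with multiplicity. For p in (0,1] all n complex roots of PC n p are real, so this is meaningful
   whenever n >= r >= 1; otherwise the value is unspecified. *)
definition beta :: "nat \<Rightarrow> nat \<Rightarrow> real \<Rightarrow> real" where
  "beta r n p = rev (sorted_list_of_multiset (proots (PC n p))) ! (r - 1)"

end

theory Submission
  imports Defs
begin

text \<open>
  For \<open>p < 1\<close> the recurrence \<open>P\<^sub>n\<^sub>+\<^sub>1(z) = z P\<^sub>n(z) - p^n P\<^sub>n(z/p)\<close> shows inductively that the roots
  \<open>x\<^sub>0 > x\<^sub>1 > \<dots>\<close> of \<open>P\<^sub>n\<close> are positive with \<open>x\<^sub>i\<^sub>+\<^sub>1 < p x\<^sub>i\<close>, the \<open>i\<close>-th root of \<open>P\<^sub>n\<^sub>+\<^sub>1\<close> lying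
  between \<open>x\<^sub>i\<close> and \<open>p x\<^sub>i\<^sub>-\<^sub>1\<close>. Hence for large \<open>n\<close> the number \<open>N\<^sub>n\<close> of roots of \<open>P\<^sub>n\<close> above \<open>t n\<close>
  changes by at most one when \<open>n\<close> grows by one. Its parity is the sign of
  \<open>P\<^sub>n(t n) / (t n)^n\<close>, which tends to \<open>F(1/t)\<close> for the deformed exponential function
  \<open>F(z) = (\<Sum>k. (-z)^k p^(k choose 2) / k!)\<close>. So \<open>N\<^sub>n\<close> is eventually constant whenever
  \<open>F(1/t) \<noteq> 0\<close>, and since \<open>F'(z) = -F(p z)\<close> forbids \<open>F\<close> to vanish on an interval, such \<open>t\<close> are
  dense. Thus the bounded sequence \<open>x\<^sub>r/n\<close> cannot oscillate.
\<close>

section \<open>The polynomials: recurrence and positivity beyond n\<close>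

lemma poly_PC:
  "poly (PC n p) z = (\<Sum>k\<le>n. (-1) ^ k * real (n choose k) * p ^ (k choose 2) * z ^ (n - k))"
  by (simp add: PC_def poly_sum poly_monom atLeast0AtMost)

lemma PC_0 [simp]: "PC 0 p = 1"
  by (simp add: PC_def numeral_2_eq_2)

lemma coeff_PC_self: "coeff (PC n p) n = 1"
proof -
  have "coeff (PC n p) n = (\<Sum>k\<in>{0..n}. if k = 0 then 1 else 0)"
    unfolding PC_def coeff_sum by (rule sum.cong) (auto simp: numeral_2_eq_2)
  then show ?thesis by simp
qed

lemma degree_PC_le: "degree (PC n p) \<le> n"
  unfolding PC_def
  by (rule degree_sum_le) (auto intro: order_trans[OF degree_monom_le])

lemma Suc_choose_two: "Suc k choose 2 = k + (k choose 2)"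
  by (simp add: numeral_2_eq_2)

text \<open>Pascal's rule together with \<open>Suc_choose_two\<close> gives the coefficient
  recursion \<open>aS\<close>. Its factor p^k is absorbed by rescaling the argument, because p^n
  (z/p)^(n-k) = p^k z^(n-k).\<close>

lemma PC_Suc:
  assumes "p \<noteq> 0"
  shows "poly (PC (Suc n) p) z = z * poly (PC n p) z - p ^ n * poly (PC n p) (z / p)"
proof -
  define a where "a n k = (-1) ^ k * real (n choose k) * p ^ (k choose 2)" for n k
  have P: "poly (PC n p) z = (\<Sum>k\<le>n. a n k * z ^ (n - k))" for n z
    by (simp add: poly_PC a_def)
  have a0: "a n 0 = 1" for n
    by (simp add: a_def numeral_2_eq_2)
  have aS: "a (Suc n) (Suc k) = a n (Suc k) - p ^ k * a n k" for k
    by (simp add: a_def Suc_choose_two algebra_simps power_add)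
  have "z * poly (PC n p) z = (\<Sum>k\<le>n. a n k * z ^ (Suc n - k))"
    unfolding P sum_distrib_left by (rule sum.cong) (auto simp: Suc_diff_le)
  also have "\<dots> = (\<Sum>k\<le>Suc n. a n k * z ^ (Suc n - k))"
    by (simp add: a_def)
  also have "\<dots> = z ^ Suc n + (\<Sum>k\<le>n. a n (Suc k) * z ^ (n - k))"
    by (subst sum.atMost_Suc_shift) (simp add: a0)
  finally have 1: "z * poly (PC n p) z = z ^ Suc n + (\<Sum>k\<le>n. a n (Suc k) * z ^ (n - k))" .
  have 2: "p ^ n * poly (PC n p) (z / p) = (\<Sum>k\<le>n. p ^ k * a n k * z ^ (n - k))"
    unfolding P sum_distrib_left
  proof (rule sum.cong)
    fix k assume "k \<in> {..n}"
    then have "p ^ n = p ^ k * p ^ (n - k)"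
      by (simp flip: power_add)
    then show "p ^ n * (a n k * (z / p) ^ (n - k)) = p ^ k * a n k * z ^ (n - k)"
      using assms by (simp add: power_divide)
  qed simp
  have "poly (PC (Suc n) p) z = z ^ Suc n + (\<Sum>k\<le>n. a (Suc n) (Suc k) * z ^ (n - k))"
    unfolding P by (subst sum.atMost_Suc_shift) (simp add: a0)
  then show ?thesis
    unfolding 1 2 aS by (simp add: left_diff_distrib sum_subtractf)
qed

text \<open>The two bounds feed each other through the recurrence: the new lower bound uses the old
  upper bound at z/p, and the new upper bound uses nonnegativity at z/p, which follows from the old
  lower bound. The lower bound is multiplied through by z so that no exponent n - 1 occurs.\<close>

lemma PC_bounds:
  assumes "0 < p" "p \<le> 1" "real n \<le> z" "0 < z"
  shows "z ^ Suc n - real n * z ^ n \<le> z * poly (PC n p) z \<and> poly (PC n p) z \<le> z ^ n"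
  using assms(3,4)
proof (induction n arbitrary: z)
  case 0
  then show ?case by simp
next
  case (Suc n)
  have "z \<le> z / p"
    using Suc.prems assms by (simp add: pos_le_divide_eq mult_left_le)
  then have z: "real n \<le> z" "real n \<le> z / p" "0 < z / p" "z > 0"
    using Suc.prems by linarith+
  note b1 = Suc.IH[OF z(1) z(4)] and b2 = Suc.IH[OF z(2,3)]
  have "0 \<le> (z / p - real n) * (z / p) ^ n"
    using z by simp
  then have "0 \<le> z / p * poly (PC n p) (z / p)"
    using b2 by (simp add: algebra_simps)
  then have "0 \<le> poly (PC n p) (z / p)"
    using z(3) zero_le_mult_iff[of "z / p" "poly (PC n p) (z / p)"] by linarith
  then have l: "0 \<le> p ^ n * poly (PC n p) (z / p)"
    using assms by simp
  have "p ^ n * poly (PC n p) (z / p) \<le> p ^ n * (z / p) ^ n"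
    using b2 assms by (intro mult_left_mono) auto
  also have "\<dots> = z ^ n"
    using assms by (simp add: power_divide)
  finally have u: "p ^ n * poly (PC n p) (z / p) \<le> z ^ n" .
  have "z ^ Suc n - real (Suc n) * z ^ n \<le> poly (PC (Suc n) p) z"
    using b1 u assms by (simp add: PC_Suc algebra_simps)
  then have "z * (z ^ Suc n - real (Suc n) * z ^ n) \<le> z * poly (PC (Suc n) p) z"
    using z by (intro mult_left_mono) auto
  moreover have "z * poly (PC n p) z \<le> z * z ^ n"
    using b1 z by (intro mult_left_mono) auto
  ultimately show ?case
    using l assms by (simp add: PC_Suc algebra_simps)
qed

lemma PC_pos:
  assumes "0 < p" "p \<le> 1" "real n < z"
  shows "0 < poly (PC n p) z"
proof -
  have z: "z > 0" using assms by linarith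
  have "0 < (z - real n) * z ^ n"
    using assms z by simp
  also have "\<dots> \<le> z * poly (PC n p) z"
    using PC_bounds[of p n z] assms z by (simp add: algebra_simps)
  finally show ?thesis
    using z by (simp add: zero_less_mult_iff)
qed

section \<open>Root lists: identification with \<open>beta\<close>, signs, interlacing\<close>

lemma beta_eq:
  assumes "\<And>z. poly (PC n p) z = (\<Prod>i<n. z - x i)" "\<And>i j. i \<le> j \<Longrightarrow> j < n \<Longrightarrow> x j \<le> x i" "i < n"
  shows "beta (Suc i) n p = x i"
proof -
  have "PC n p = (\<Prod>i<n. [:- x i, 1:])"
    using assms(1) by (intro poly_eq_poly_eq_iff[THEN iffD1] ext) (simp add: poly_prod)
  then have "proots (PC n p) = mset (map x [0..<n])"
    by (simp add: proots_prod sum_unfold_sum_mset lessThan_atLeast0)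
  then have "proots (PC n p) = mset (rev (map x [0..<n]))"
    by simp
  moreover have "sorted (rev (map x [0..<n]))"
    using assms(2) by (auto simp: sorted_rev_iff_nth_mono)
  ultimately show ?thesis
    using assms(3) by (simp add: beta_def sorted_sort_id del: mset_rev mset_map)
qed

text \<open>Exactly the first i factors are negative.\<close>

lemma sign_prod_diff:
  fixes x :: "nat \<Rightarrow> real"
  assumes "i \<le> n" "\<And>j. j < i \<Longrightarrow> z < x j" "\<And>j. i \<le> j \<Longrightarrow> j < n \<Longrightarrow> x j < z"
  shows "0 < (-1) ^ i * (\<Prod>j<n. z - x j)"
proof -
  have "(\<Prod>j<n. z - x j) = (\<Prod>j<i. z - x j) * (\<Prod>j\<in>{i..<n}. z - x j)"
    using assms(1) by (simp add: lessThan_atLeast0 prod.atLeastLessThan_concat)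
  moreover have "(-1) ^ i * (\<Prod>j<i. z - x j) = (\<Prod>j<i. x j - z)"
    using prod.distrib[of "\<lambda>_. -1" "\<lambda>j. z - x j" "{..<i}"] by simp
  ultimately have "(-1) ^ i * (\<Prod>j<n. z - x j) = (\<Prod>j<i. x j - z) * (\<Prod>j\<in>{i..<n}. z - x j)"
    by (simp flip: mult.assoc)
  also have "\<dots> > 0"
    using assms by (intro mult_pos_pos prod_pos) auto
  finally show ?thesis .
qed

text \<open>The gap factor p is what the induction carries along: multiplying or dividing a single
  root by p then passes no other root, so the sign of the polynomial at the moved point is
  known.\<close>

definition separated_roots :: "real \<Rightarrow> nat \<Rightarrow> (nat \<Rightarrow> real) \<Rightarrow> bool" where
  "separated_roots p n x \<longleftrightarrow> (\<forall>i<n. 0 < x i) \<and> (\<forall>i. Suc i < n \<longrightarrow> x (Suc i) < p * x i) \<and>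
     (\<forall>z. poly (PC n p) z = (\<Prod>i<n. z - x i))"

lemma separated_roots_less:
  assumes "separated_roots p n x" "0 < p" "p \<le> 1" "i < j" "j < n"
  shows "x j < p * x i"
  using assms(4,5)
proof (induction j)
  case (Suc j)
  have *: "x (Suc j) < p * x j" "0 < x j"
    using assms(1) Suc.prems by (auto simp: separated_roots_def)
  show ?case
  proof (cases "i = j")
    case False
    then have "x j < p * x i" using Suc by auto
    moreover have "p * x j \<le> x j"
      using * assms by (simp add: mult_left_le_one_le)
    ultimately show ?thesis using * by linarith
  qed (use * in simp)
qed simp

lemma separated_roots_decreasing:
  assumes "separated_roots p n x" "0 < p" "p \<le> 1" "i < j" "j < n"
  shows "x j < x i"
proof -
  have "0 < x i" using assms by (auto simp: separated_roots_def)
  then have "p * x i \<le> x i"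
    using assms by (simp add: mult_left_le_one_le)
  then show ?thesis using separated_roots_less[OF assms] by linarith
qed

text \<open>At a root x_i the recurrence leaves only -p^n P_n(x_i/p), and at p x_i it leaves only p
  x_i P_n(p x_i). Separation determines both signs, and they force a root of the next polynomial in
  each of n + 1 disjoint intervals.\<close>

lemma separated_roots_Suc:
  assumes S: "separated_roots p n x" and p: "0 < p" "p < 1"
  shows "\<exists>y. separated_roots p (Suc n) y \<and> (\<forall>i<n. x i < y i) \<and> (\<forall>i<n. y (Suc i) < p * x i)"
proof -
  let ?P = "poly (PC (Suc n) p)"
  have pos: "0 < x i" if "i < n" for i
    using S that by (auto simp: separated_roots_def)
  have prod: "poly (PC n p) z = (\<Prod>i<n. z - x i)" for z
    using S by (auto simp: separated_roots_def)
  have less: "x j < p * x i" "x j < x i" if "i < j" "j < n" for i j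
    using separated_roots_less[OF S] separated_roots_decreasing[OF S] p that by auto
  \<comment> \<open>The i-th interval is (\<open>u i\<close>, \<open>v i\<close>). The lowest one
    starts at 0, and the highest one ends beyond both x_0 and n + 1, where \<open>PC_pos\<close>
    applies.\<close>
  define u where "u i = (if i < n then x i else 0)" for i
  define v where "v i = (case i of 0 \<Rightarrow> real n + 2 + \<bar>x 0\<bar> | Suc j \<Rightarrow> p * x j)" for i
  have u0: "0 \<le> u i" for i
    using pos by (auto simp: u_def less_imp_le)
  have uv: "u i < v i" if "i \<le> n" for i
    using that less pos p by (auto simp: u_def v_def split: nat.splits)
  have sv: "0 < (-1) ^ i * ?P (v i)" if "i \<le> n" for i
  proof (cases i)
    case 0
    then show ?thesis using PC_pos[of p "Suc n"] p by (auto simp: v_def)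
  next
    case (Suc j)
    then have j: "j < n" using that by simp
    have "0 < (-1) ^ Suc j * (\<Prod>k<n. p * x j - x k)"
    proof (rule sign_prod_diff)
      fix k assume "k < Suc j"
      moreover have "p * x j < x j" using pos[OF j] p by simp
      ultimately show "p * x j < x k"
        using less(2)[of k j] j by (cases "k = j") auto
    qed (use j less in auto)
    then have gt: "0 < p * x j * ((-1) ^ Suc j * (\<Prod>k<n. p * x j - x k))"
      by (rule mult_pos_pos[rotated]) (use p pos[OF j] in simp)
    have "poly (PC n p) (p * x j / p) = 0"
      using p j by (simp add: prod) (auto intro!: prod_zero)
    then have "(-1) ^ i * ?P (v i) = p * x j * ((-1) ^ Suc j * (\<Prod>k<n. p * x j - x k))"
      using p by (simp add: PC_Suc Suc v_def prod)
    with gt show ?thesis by simp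
  qed
  have su: "(-1) ^ i * ?P (u i) < 0" if "i \<le> n" for i
  proof (cases "i < n")
    case True
    have "0 < (-1) ^ i * (\<Prod>k<n. x i / p - x k)"
    proof (rule sign_prod_diff)
      fix k assume k: "i \<le> k" "k < n"
      have "x i < x i / p" using pos[OF True] p by (simp add: field_simps)
      then show "x k < x i / p"
        using less(2)[of i k] k by (cases "k = i") auto
    next
      fix k assume "k < i"
      then show "x i / p < x k" using less(1)[of k i] True p by (simp add: field_simps)
    qed (use True in auto)
    then have "0 < p ^ n * ((-1) ^ i * (\<Prod>k<n. x i / p - x k))"
      by (rule mult_pos_pos[rotated]) (use p in simp)
    moreover have "poly (PC n p) (x i) = 0"
      using True by (simp add: prod) (auto intro!: prod_zero)
    then have "?P (u i) = - (p ^ n * poly (PC n p) (x i / p))"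
      using p True by (simp add: PC_Suc u_def)
    ultimately show ?thesis
      by (simp add: prod mult_ac)
  next
    case False
    then have [simp]: "i = n" using that by simp
    have "0 < (-1) ^ n * (\<Prod>k<n. 0 - x k)"
      by (rule sign_prod_diff) (use pos in auto)
    then have "0 < p ^ n * ((-1) ^ n * (\<Prod>k<n. 0 - x k))"
      by (rule mult_pos_pos[rotated]) (use p in simp)
    then show ?thesis
      using p by (simp add: PC_Suc u_def prod mult_ac)
  qed
  have "\<exists>y. u i < y \<and> y < v i \<and> ?P y = 0" if "i \<le> n" for i
  proof -
    \<comment> \<open>The factor (-1)^i turns every sign change into one from negative to positive,
      so one form of the intermediate value theorem covers both parities.\<close>
    have "\<exists>y>u i. y < v i \<and> poly (smult ((-1) ^ i) (PC (Suc n) p)) y = 0"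
      by (rule poly_IVT_pos[simplified]) (use uv su sv that in auto)
    then show ?thesis by auto
  qed
  then obtain y where y: "\<And>i. i \<le> n \<Longrightarrow> u i < y i \<and> y i < v i \<and> ?P (y i) = 0"
    by metis
  have xy: "x i < y i" if "i < n" for i
    using y[of i] that by (auto simp: u_def)
  have yx: "y (Suc i) < p * x i" if "i < n" for i
    using y[of "Suc i"] that by (auto simp: v_def)
  have ypos: "0 < y i" if "i < Suc n" for i
    using y[of i] u0[of i] that by auto
  have ysep: "y (Suc i) < p * y i" if "Suc i < Suc n" for i
    using xy[of i] yx[of i] that p by (auto intro: less_trans)
  have ydec: "y j < y i" if "i < j" "j < Suc n" for i j
    using that
  proof (induction j)
    case (Suc j)
    have "p * y j < y j" using ypos[of j] Suc.prems p by simp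
    then show ?case
      using ysep[of j] Suc by (cases "i = j") auto
  qed simp
  have inj: "inj_on y {..<Suc n}"
    by (rule linorder_inj_onI') (use ydec in force)
  \<comment> \<open>Both sides are monic of degree n + 1 and agree at the n + 1 distinct points
    y_i.\<close>
  have "PC (Suc n) p = (\<Prod>i<Suc n. [:- y i, 1:])"
  proof (rule poly_eqI_degree_lead_coeff[where n = "Suc n" and A = "y ` {..<Suc n}"])
    have m: "degree (\<Prod>i<Suc n. [:- y i, 1:]) = Suc n"
      by (subst degree_prod_sum_eq) auto
    then show "degree (\<Prod>i<Suc n. [:- y i, 1:]) \<le> Suc n" by simp
    have "lead_coeff (\<Prod>i<Suc n. [:- y i, 1:]) = 1"
      by (subst lead_coeff_prod) simp
    then show "coeff (PC (Suc n) p) (Suc n) = coeff (\<Prod>i<Suc n. [:- y i, 1:]) (Suc n)"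
      by (simp only: m coeff_PC_self)
    show "card (y ` {..<Suc n}) \<ge> Suc n"
      using card_image[OF inj] by simp
    fix z assume "z \<in> y ` {..<Suc n}"
    then obtain i where "i < Suc n" "z = y i" by auto
    moreover from this have "poly (\<Prod>i<Suc n. [:- y i, 1:]) z = 0"
      unfolding poly_prod by (intro prod_zero) auto
    ultimately show "?P z = poly (\<Prod>i<Suc n. [:- y i, 1:]) z"
      using y[of i] by simp
  qed (rule degree_PC_le)
  then have "?P z = (\<Prod>i<Suc n. z - y i)" for z
    by (simp add: poly_prod del: prod.lessThan_Suc)
  then have "separated_roots p (Suc n) y"
    using ypos ysep by (simp add: separated_roots_def)
  then show ?thesis
    using xy yx by blast
qed

text \<open>Dependent choice is used because each list has to interlace with the one chosen just
  before it.\<close>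

lemma root_arrays_exist:
  assumes "0 < p" "p < 1"
  obtains x where "\<And>n. separated_roots p n (x n)" "\<And>n i. i < n \<Longrightarrow> x n i < x (Suc n) i"
    "\<And>n i. i < n \<Longrightarrow> x (Suc n) (Suc i) < p * x n i"
proof -
  have "\<exists>x. \<forall>n. separated_roots p n (x n) \<and>
      (\<forall>i<n. x n i < x (Suc n) i) \<and> (\<forall>i<n. x (Suc n) (Suc i) < p * x n i)"
    by (rule dependent_nat_choice)
       (use separated_roots_Suc[OF _ assms] in \<open>auto simp: separated_roots_def\<close>)
  then show ?thesis using that by blast
qed

section \<open>The deformed exponential function\<close>

definition deformed_exp_coeff :: "real \<Rightarrow> nat \<Rightarrow> real" where
  "deformed_exp_coeff p k = (-1) ^ k * p ^ (k choose 2) / fact k"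

definition deformed_exp :: "real \<Rightarrow> real \<Rightarrow> real" where
  "deformed_exp p z = (\<Sum>k. deformed_exp_coeff p k * z ^ k)"

lemma summable_deformed_exp:
  assumes "0 < p" "p \<le> 1"
  shows "summable (\<lambda>k. deformed_exp_coeff p k * z ^ k)"
proof (rule summable_comparison_test'[where N = 0])
  show "summable (\<lambda>k. \<bar>z\<bar> ^ k / fact k)"
    using summable_exp[of "\<bar>z\<bar>"] by (simp add: divide_inverse mult.commute)
  show "norm (deformed_exp_coeff p k * z ^ k) \<le> \<bar>z\<bar> ^ k / fact k" for k
    using assms power_le_one[of p "k choose 2"]
    by (simp add: deformed_exp_coeff_def abs_mult power_abs divide_right_mono mult_left_le_one_le)
qed

text \<open>Termwise differentiation shifts the coefficients, and \<open>Suc_choose_two\<close>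
  turns the shift into a factor p^k, that is, into evaluation at p z. For p = 1 the function is
  exp(-z).\<close>

lemma DERIV_deformed_exp:
  assumes "0 < p" "p \<le> 1"
  shows "(deformed_exp p has_field_derivative - deformed_exp p (p * z)) (at z)"
proof -
  have "diffs (deformed_exp_coeff p) k * z ^ k = - (deformed_exp_coeff p k * (p * z) ^ k)" for k
    by (simp add: diffs_def deformed_exp_coeff_def Suc_choose_two power_add power_mult_distrib
        field_simps del: of_nat_Suc)
  then have "(\<Sum>k. diffs (deformed_exp_coeff p) k * z ^ k) = - deformed_exp p (p * z)"
    using summable_deformed_exp[OF assms, of "p * z"] by (simp add: deformed_exp_def suminf_minus)
  then show ?thesis
    using termdiffs_strong_converges_everywhere[OF summable_deformed_exp[OF assms], of z]
    unfolding deformed_exp_def by simp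
qed

lemma deformed_exp_0: "deformed_exp p 0 = 1"
  unfolding deformed_exp_def by (subst powser_zero) (simp add: deformed_exp_coeff_def numeral_2_eq_2)

text \<open>If F vanishes on an open interval, so does F', hence F(p z) = 0 there. Iterating, F(p^k
  z) = 0 for all k, and letting k grow contradicts continuity at 0 and F(0) = 1.\<close>

lemma deformed_exp_nonzero_between:
  assumes p: "0 < p" "p < 1" and ab: "a < b"
  shows "\<exists>z\<in>{a<..<b}. deformed_exp p z \<noteq> 0"
proof (rule ccontr)
  assume "\<not> ?thesis"
  then have zero: "deformed_exp p z = 0" if "a < z" "z < b" for z
    using that by auto
  have "\<forall>z. a < z \<and> z < b \<longrightarrow> deformed_exp p (p ^ k * z) = 0" for k
  proof (induction k)
    case (Suc k)
    show ?case
    proof (intro allI impI)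
      fix z assume z: "a < z \<and> z < b"
      have "((\<lambda>z. deformed_exp p (p ^ k * z)) has_field_derivative
          - deformed_exp p (p * (p ^ k * z)) * p ^ k) (at z)"
        using p by (intro DERIV_chain2[OF DERIV_deformed_exp] DERIV_cmult_Id) auto
      moreover have "\<forall>\<^sub>F z in nhds z. deformed_exp p (p ^ k * z) = 0"
        using Suc z eventually_nhds_in_open[of "{a<..<b}" z] by (auto elim!: eventually_mono)
      then have "((\<lambda>z. deformed_exp p (p ^ k * z)) has_field_derivative 0) (at z)"
        by (subst DERIV_cong_ev[OF refl _ refl, of _ "\<lambda>_. 0"]) auto
      ultimately have "- deformed_exp p (p * (p ^ k * z)) * p ^ k = 0"
        by (rule DERIV_unique)
      then show "deformed_exp p (p ^ Suc k * z) = 0"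
        using p by (simp add: mult_ac)
    qed
  qed (use zero in auto)
  moreover have "a < (a + b) / 2 \<and> (a + b) / 2 < b"
    using ab by auto
  ultimately have "(\<lambda>k. deformed_exp p (p ^ k * ((a + b) / 2))) = (\<lambda>_. 0)"
    by metis
  moreover have "(\<lambda>k. deformed_exp p (p ^ k * ((a + b) / 2))) \<longlonglongrightarrow> deformed_exp p (0 * ((a + b) / 2))"
  proof (rule isCont_tendsto_compose[where g = "deformed_exp p"])
    show "isCont (deformed_exp p) (0 * ((a + b) / 2))"
      using DERIV_deformed_exp[of p] p by (auto intro: DERIV_isCont)
    show "(\<lambda>k. p ^ k * ((a + b) / 2)) \<longlonglongrightarrow> 0 * ((a + b) / 2)"
      using p by (intro tendsto_intros) (auto intro: LIMSEQ_realpow_zero)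
  qed
  ultimately show False
    by (auto simp: deformed_exp_0 LIMSEQ_const_iff)
qed

section \<open>Limit of the rescaled polynomials\<close>

lemma binomial_over_power_tendsto: "(\<lambda>n. real (n choose k) / real n ^ k) \<longlonglongrightarrow> 1 / fact k"
proof (induction k)
  case (Suc k)
  have "(\<lambda>n. real (n choose k) / real n ^ k * (1 - real k / real n) / real (Suc k))
      \<longlonglongrightarrow> 1 / fact k * (1 - 0) / real (Suc k)"
    by (intro tendsto_intros Suc lim_const_over_n) simp
  moreover have "\<forall>\<^sub>F n in sequentially.
      real (n choose k) / real n ^ k * (1 - real k / real n) / real (Suc k)
      = real (n choose Suc k) / real n ^ Suc k"
    using eventually_gt_at_top[of k]
  proof eventually_elim
    case (elim n)
    have "real (Suc k) * real (n choose Suc k) = (real n - real k) * real (n choose k)"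
      using binomial_absorb_comp[of n k] elim binomial_absorption[of k n]
      by (metis less_imp_le of_nat_diff of_nat_mult binomial_absorption binomial_absorb_comp)
    then have "real (n choose Suc k) = (real n - real k) * real (n choose k) / real (Suc k)"
      by (simp add: field_simps)
    moreover have "1 - real k / real n = (real n - real k) / real n"
      using elim by (simp add: field_simps)
    ultimately show ?case
      by (simp add: mult_ac)
  qed
  ultimately show ?case
    by (auto elim!: Lim_transform_eventually simp: mult.commute)
qed simp

text \<open>After division by (t n)^n each term converges as n grows, and the k-th one is dominated
  by (1/t)^k / k! uniformly in n. Tannery's theorem then exchanges limit and sum.\<close>

lemma PC_rescaled_tendsto:
  assumes p: "0 < p" "p \<le> 1" and t: "0 < t"
  shows "(\<lambda>n. poly (PC n p) (t * real n) / (t * real n) ^ n) \<longlonglongrightarrow> deformed_exp p (1 / t)"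
proof -
  \<comment> \<open>For k > n the binomial coefficient is 0, so the finite sum becomes a series
    whose range is independent of n.\<close>
  define a where "a k n = (-1) ^ k * p ^ (k choose 2) * (real (n choose k) / real n ^ k) * (1 / t) ^ k" for k n
  have "(\<lambda>n. suminf (\<lambda>k. a k n)) \<longlonglongrightarrow> (\<Sum>k. deformed_exp_coeff p k * (1 / t) ^ k)"
  proof (rule tannerys_theorem[THEN conjunct2, THEN conjunct2])
    show "(\<lambda>n. a k n) \<longlonglongrightarrow> deformed_exp_coeff p k * (1 / t) ^ k" for k
      unfolding a_def deformed_exp_coeff_def
      by (rule tendsto_eq_intros binomial_over_power_tendsto refl)+ simp
    show "summable (\<lambda>k. (1 / t) ^ k / fact k)"
      using summable_exp[of "1 / t"] by (simp add: divide_inverse mult.commute)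
    have "norm (a k n) \<le> (1 / t) ^ k / fact k" for k n
    proof -
      have "real (n choose k) / real n ^ k \<le> 1 / fact k"
      proof (cases "n = 0")
        case False
        have "real (n choose k) * fact k \<le> real n ^ k"
          using binomial_fact_pow[of n k] by (metis of_nat_fact of_nat_le_iff of_nat_mult of_nat_power)
        then show ?thesis using False by (simp add: field_simps)
      qed (cases k; simp)
      then have "p ^ (k choose 2) * (real (n choose k) / real n ^ k) \<le> 1 * (1 / fact k)"
        using p by (intro mult_mono power_le_one) auto
      then have "p ^ (k choose 2) * (real (n choose k) / real n ^ k) * (1 / t) ^ k \<le> 1 / fact k * (1 / t) ^ k"
        using t by (intro mult_right_mono) auto
      then show ?thesis
        using p t by (simp add: a_def abs_mult power_abs)
    qed
    then show "\<forall>\<^sub>F (k, n) in sequentially \<times>\<^sub>F sequentially. norm (a k n) \<le> (1 / t) ^ k / fact k"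
      by (auto intro: always_eventually)
  qed simp
  moreover have "suminf (\<lambda>k. a k n) = poly (PC n p) (t * real n) / (t * real n) ^ n" if "n > 0" for n
  proof -
    have "suminf (\<lambda>k. a k n) = (\<Sum>k\<le>n. a k n)"
      by (rule suminf_finite) (auto simp: a_def)
    also have "\<dots> = poly (PC n p) (t * real n) / (t * real n) ^ n"
      unfolding poly_PC sum_divide_distrib
    proof (rule sum.cong)
      fix k assume "k \<in> {..n}"
      then have "(t * real n) ^ n = (t * real n) ^ k * (t * real n) ^ (n - k)"
        by (simp flip: power_add)
      then show "a k n = (-1) ^ k * real (n choose k) * p ^ (k choose 2) * (t * real n) ^ (n - k)
          / (t * real n) ^ n"
        using t that by (simp add: a_def power_mult_distrib power_divide mult_ac)
    qed simp
    finally show ?thesis .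
  qed
  then have "\<forall>\<^sub>F n in sequentially. suminf (\<lambda>k. a k n) = poly (PC n p) (t * real n) / (t * real n) ^ n"
    by (rule eventually_mono[OF eventually_gt_at_top[of 0]])
  ultimately show ?thesis
    unfolding deformed_exp_def by (rule Lim_transform_eventually)
qed

section \<open>Root counts above a linear threshold\<close>

lemma downward_closed_eq_lessThan_card:
  fixes A :: "nat set"
  assumes "finite A" "\<And>i j. i \<le> j \<Longrightarrow> j \<in> A \<Longrightarrow> i \<in> A"
  shows "A = {..<card A}"
proof -
  define m where "m = (LEAST m. m \<notin> A)"
  have "\<exists>m. m \<notin> A" using assms(1) by (metis ex_new_if_finite infinite_UNIV_nat)
  then have "m \<notin> A" unfolding m_def by (rule LeastI_ex)
  moreover have "i \<in> A" if "i < m" for i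
    using that not_less_Least m_def by blast
  ultimately have "A = {..<m}"
    using assms(2) by (metis lessThan_iff linorder_not_less subsetI subset_antisym)
  then show ?thesis by simp
qed

text \<open>The limit is the supremum of the eventual strict lower bounds. A decided level above
  this supremum cannot be such a bound, so it must be an eventual upper bound.\<close>

lemma convergent_if_not_oscillating:
  fixes s :: "nat \<Rightarrow> real"
  assumes bounds: "\<forall>\<^sub>F n in sequentially. 0 < s n \<and> s n \<le> 1"
    and decide: "\<And>a b. 0 < a \<Longrightarrow> a < b \<Longrightarrow>
      \<exists>t\<in>{a<..<b}. (\<forall>\<^sub>F n in sequentially. t < s n) \<or> (\<forall>\<^sub>F n in sequentially. s n \<le> t)"
  shows "convergent s"
proof -
  define T where "T = {t. \<forall>\<^sub>F n in sequentially. t < s n}"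
  have "0 \<in> T"
    using bounds by (auto simp: T_def elim: eventually_mono)
  have "t \<le> 1" if "t \<in> T" for t
  proof -
    have "\<forall>\<^sub>F n in sequentially. t < 1"
      using that bounds unfolding T_def mem_Collect_eq by eventually_elim auto
    then show ?thesis by simp
  qed
  then have bdd: "bdd_above T" by (auto simp: bdd_above_def)
  have "s \<longlonglongrightarrow> Sup T"
  proof (rule order_tendstoI)
    fix a assume "a < Sup T"
    then obtain t where "t \<in> T" "a < t"
      using less_cSup_iff[of T a] \<open>0 \<in> T\<close> bdd by auto
    then show "\<forall>\<^sub>F n in sequentially. a < s n"
      by (auto simp: T_def elim: eventually_mono)
  next
    fix b assume b: "Sup T < b"
    have "0 \<le> Sup T" using \<open>0 \<in> T\<close> bdd by (rule cSup_upper)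
    \<comment> \<open>The supremum may be 0; the midpoint provides the positive left endpoint that
      \<open>decide\<close> requires.\<close>
    then obtain t where t: "(Sup T + b) / 2 < t" "t < b"
      "(\<forall>\<^sub>F n in sequentially. t < s n) \<or> (\<forall>\<^sub>F n in sequentially. s n \<le> t)"
      using decide[of "(Sup T + b) / 2" b] b by auto
    have "t \<notin> T" using cSup_upper[OF _ bdd, of t] t(1) b by auto
    then have "\<forall>\<^sub>F n in sequentially. s n \<le> t"
      using t(3) by (auto simp: T_def)
    then show "\<forall>\<^sub>F n in sequentially. s n < b"
      using t(2) by (auto elim: eventually_mono)
  qed
  then show ?thesis by (auto simp: convergent_def)
qed

lemma scaled_root_decided:
  assumes p: "0 < p" "p < 1" and t: "0 < t" "deformed_exp p (1 / t) \<noteq> 0"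
    and S: "\<And>n. separated_roots p n (x n)"
    and incr: "\<And>n i. i < n \<Longrightarrow> x n i < x (Suc n) i"
    and interlace: "\<And>n i. i < n \<Longrightarrow> x (Suc n) (Suc i) < p * x n i"
  shows "(\<forall>\<^sub>F n in sequentially. t * real n < x n i) \<or> (\<forall>\<^sub>F n in sequentially. x n i \<le> t * real n)"
proof -
  define A where "A n = {i. i < n \<and> t * real n < x n i}" for n
  define N where "N n = card (A n)" for n
  have fin: "finite (A n)" for n by (auto simp: A_def)
  have dec: "x n j \<le> x n i" if "i \<le> j" "j < n" for n i j
    using separated_roots_decreasing[OF S[of n], of i j] p that by (cases "i = j") auto
  have A_eq: "A n = {..<N n}" for n
    unfolding N_def
  proof (rule downward_closed_eq_lessThan_card[OF fin])
    fix i j assume "i \<le> j" "j \<in> A n"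
    then show "i \<in> A n" using dec[of i j n] by (auto simp: A_def)
  qed
  have N_le: "N n \<le> n" for n
  proof -
    have "card (A n) \<le> card {..<n}" by (rule card_mono) (auto simp: A_def)
    then show ?thesis by (simp add: N_def)
  qed
  \<comment> \<open>With two additional roots above the threshold, the root of index N_n + 1 at
    stage n + 1 would exceed t (n + 1). Interlacing puts it below the root of index N_n at stage n,
    which would then exceed t n.\<close>
  have up: "N (Suc n) \<le> Suc (N n)" for n
  proof (rule ccontr)
    assume "\<not> ?thesis"
    then have "Suc (N n) \<in> A (Suc n)" by (simp add: A_eq)
    then have 1: "N n < n" "t * real (Suc n) < x (Suc n) (Suc (N n))" by (auto simp: A_def)
    have "0 < x n (N n)" using S[of n] 1 by (auto simp: separated_roots_def)
    then have "p * x n (N n) < x n (N n)" using p by simp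
    moreover have "t * real n \<le> t * real (Suc n)" using t by simp
    ultimately have "t * real n < x n (N n)" using 1 interlace[of "N n" n] by linarith
    then have "N n \<in> A n" using 1 by (simp add: A_def)
    then show False by (simp add: A_eq)
  qed
  have "\<forall>\<^sub>F n in sequentially. p * real (Suc n) \<le> real n"
  proof -
    have "\<forall>\<^sub>F n in sequentially. p / (1 - p) \<le> real n"
      by (rule eventually_compose_filterlim[OF eventually_ge_at_top filterlim_real_sequentially])
    then show ?thesis
      using p by (auto elim!: eventually_mono simp: field_simps)
  qed
  \<comment> \<open>Let m = N_(n+1). If two roots were lost, the root of index m + 1 at stage n
    would exceed t n. By separation the root of index m exceeds t n / p, which is at least t (n + 1)
    for large n. Roots of fixed index grow with n, so stage n + 1 would have more than m roots above
    its threshold.\<close>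
  then have down: "\<forall>\<^sub>F n in sequentially. N n \<le> Suc (N (Suc n))"
  proof eventually_elim
    case (elim n)
    show ?case
    proof (rule ccontr)
      assume "\<not> ?case"
      then have "Suc (N (Suc n)) \<in> A n" by (simp add: A_eq)
      then have 1: "Suc (N (Suc n)) < n" "t * real n < x n (Suc (N (Suc n)))" by (auto simp: A_def)
      have "p * (t * real (Suc n)) \<le> t * real n"
        using mult_left_mono[OF elim, of t] t by (simp add: mult_ac)
      also have "\<dots> < p * x n (N (Suc n))"
        using 1 separated_roots_less[OF S[of n], of "N (Suc n)" "Suc (N (Suc n))"] p by linarith
      finally have "t * real (Suc n) < x n (N (Suc n))" using p by simp
      also have "\<dots> < x (Suc n) (N (Suc n))" using incr 1 by simp
      finally have "N (Suc n) \<in> A (Suc n)" using 1 by (simp add: A_def)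
      then show False by (simp add: A_eq)
    qed
  qed
  \<comment> \<open>Nonvanishing rules out a root exactly at the threshold, so every uncounted root
    lies strictly below it.\<close>
  have sign: "0 < (-1) ^ N n * poly (PC n p) (t * real n)" if nz: "poly (PC n p) (t * real n) \<noteq> 0" for n
  proof -
    have prod: "poly (PC n p) z = (\<Prod>i<n. z - x n i)" for z
      using S[of n] by (auto simp: separated_roots_def)
    show ?thesis
      unfolding prod
    proof (rule sign_prod_diff[OF N_le])
      fix j assume "j < N n"
      then have "j \<in> A n" by (simp add: A_eq)
      then show "t * real n < x n j" by (simp add: A_def)
    next
      fix j assume j: "N n \<le> j" "j < n"
      then have "j \<notin> A n" by (simp add: A_eq)
      moreover have "t * real n \<noteq> x n j"
        using nz j unfolding prod by auto
      ultimately show "x n j < t * real n" using j by (auto simp: A_def)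
    qed
  qed
  have "\<exists>c::bool. \<forall>\<^sub>F n in sequentially. even (N n) = c"
  proof -
    let ?f = "\<lambda>n. poly (PC n p) (t * real n) / (t * real n) ^ n"
    have lim: "?f \<longlonglongrightarrow> deformed_exp p (1 / t)"
      using PC_rescaled_tendsto p t by auto
    \<comment> \<open>For n = 0 this is 0^0 = 1.\<close>
    have pow: "0 < (t * real n) ^ n" for n
      by (cases "n = 0") (use t in auto)
    have par: "0 < ?f n \<Longrightarrow> even (N n) = True" "?f n < 0 \<Longrightarrow> even (N n) = False" for n
      using sign[of n] pow[of n]
      by (cases "even (N n)"; simp add: pos_less_divide_eq pos_divide_less_eq)+
    show ?thesis
    proof (cases "0 < deformed_exp p (1 / t)")
      case True
      then have "\<forall>\<^sub>F n in sequentially. 0 < ?f n" by (rule order_tendstoD(1)[OF lim])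
      then have "\<forall>\<^sub>F n in sequentially. even (N n) = True"
        by (rule eventually_mono) (use par in blast)
      then show ?thesis by blast
    next
      case False
      then have "deformed_exp p (1 / t) < 0" using t by simp
      then have "\<forall>\<^sub>F n in sequentially. ?f n < 0" by (rule order_tendstoD(2)[OF lim])
      then have "\<forall>\<^sub>F n in sequentially. even (N n) = False"
        by (rule eventually_mono) (use par in blast)
      then show ?thesis by blast
    qed
  qed
  then obtain c where c: "\<forall>\<^sub>F n in sequentially. even (N n) = c" by blast
  then have c': "\<forall>\<^sub>F n in sequentially. even (N (Suc n)) = c"
    by (rule eventually_sequentially_Suc[THEN iffD2])
  have "\<forall>\<^sub>F n in sequentially. N (Suc n) = N n"
    using c c' down
  proof eventually_elim
    case (elim n)
    then have "even (N (Suc n)) = even (N n)" by simp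
    moreover have "N (Suc n) = N n \<or> N (Suc n) = Suc (N n) \<or> N n = Suc (N (Suc n))"
      using elim(3) up[of n] by linarith
    ultimately show ?case by (metis even_Suc)
  qed
  then obtain m where m: "\<And>n. m \<le> n \<Longrightarrow> N (Suc n) = N n"
    by (auto simp: eventually_sequentially)
  have const: "N n = N m" if "m \<le> n" for n
    using that by (induction n rule: dec_induct) (auto simp: m)
  show ?thesis
  proof (cases "i < N m")
    case True
    have "\<forall>\<^sub>F n in sequentially. t * real n < x n i"
      using eventually_ge_at_top[of m]
    proof eventually_elim
      case (elim n)
      have "i \<in> A n" using True const[OF elim] by (simp add: A_eq)
      then show ?case by (simp add: A_def)
    qed
    then show ?thesis ..
  next
    case False
    have "\<forall>\<^sub>F n in sequentially. x n i \<le> t * real n"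
      using eventually_ge_at_top[of m] eventually_gt_at_top[of i]
    proof eventually_elim
      case (elim n)
      have "i \<notin> A n" using False const[OF elim(1)] by (simp add: A_eq)
      then show ?case using elim by (auto simp: A_def)
    qed
    then show ?thesis ..
  qed
qed

section \<open>Convergence of the scaled roots\<close>

theorem theorem10p2:
  fixes p :: real and r :: nat
  assumes "0 < p" and "p \<le> 1" and "r \<ge> 1"
  shows "convergent (\<lambda>n. beta r n p / real n)"
proof -
  obtain i where r: "r = Suc i" using assms(3) by (cases r) auto
  show ?thesis
  proof (cases "p = 1")
    case True
    \<comment> \<open>For p = 1 the polynomial is (z - 1)^n, so all roots are 1 and the quotient
      tends to 0.\<close>
    have "poly (PC n p) z = (\<Prod>i<n. z - 1)" for n z
      by (induction n) (simp_all add: True PC_Suc algebra_simps)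
    then have "beta r n p = 1" if "i < n" for n
      unfolding r by (rule beta_eq[where x = "\<lambda>_. 1"]) (use that in auto)
    then have "\<forall>\<^sub>F n in sequentially. 1 / real n = beta r n p / real n"
      by (intro eventually_mono[OF eventually_gt_at_top[of i]]) simp
    then have "(\<lambda>n. beta r n p / real n) \<longlonglongrightarrow> 0"
      by (rule Lim_transform_eventually[OF lim_const_over_n])
    then show ?thesis by (auto simp: convergent_def)
  next
    case False
    then have p: "0 < p" "p < 1" using assms by auto
    obtain x where S: "\<And>n. separated_roots p n (x n)"
      and incr: "\<And>n i. i < n \<Longrightarrow> x n i < x (Suc n) i"
      and interlace: "\<And>n i. i < n \<Longrightarrow> x (Suc n) (Suc i) < p * x n i"
      using root_arrays_exist[OF p] by blast
    have beta: "beta r n p = x n i" if "i < n" for n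
      unfolding r
    proof (rule beta_eq)
      show "x n k \<le> x n j" if "j \<le> k" "k < n" for j k
        using separated_roots_decreasing[OF S[of n], of j k] p that by (cases "j = k") auto
    qed (use S[of n] that in \<open>auto simp: separated_roots_def\<close>)
    have bound: "x n i \<le> real n" if "i < n" for n
    proof (rule ccontr)
      assume "\<not> ?thesis"
      then have "0 < poly (PC n p) (x n i)" using PC_pos p by auto
      moreover have "poly (PC n p) (x n i) = 0"
        using S[of n] that by (auto simp: separated_roots_def)
      ultimately show False by simp
    qed
    show ?thesis
    proof (rule convergent_if_not_oscillating)
      show "\<forall>\<^sub>F n in sequentially. 0 < beta r n p / real n \<and> beta r n p / real n \<le> 1"
        using eventually_gt_at_top[of i]
      proof eventually_elim
        case (elim n)
        then show ?case using bound[of n] beta[of n] S[of n] by (auto simp: separated_roots_def)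
      qed
    next
      fix a b :: real assume ab: "0 < a" "a < b"
      \<comment> \<open>The threshold t enters through F(1/t), so a nonzero of F is sought in the
        reciprocal interval and t = 1/z is taken.\<close>
      then have "1 / b < 1 / a" by (simp add: field_simps)
      then obtain z where z: "1 / b < z" "z < 1 / a" "deformed_exp p z \<noteq> 0"
        using deformed_exp_nonzero_between[OF p, of "1 / b" "1 / a"] by auto
      have "0 < 1 / b" using ab by simp
      then have z0: "0 < z" using z by linarith
      \<comment> \<open>The index i is a valid position among the n roots only when i < n, so the
        identification with \<open>beta\<close> holds eventually.\<close>
      have ev: "\<forall>\<^sub>F n in sequentially. x n i = beta r n p \<and> 0 < n"
        by (rule eventually_mono[OF eventually_gt_at_top[of i]]) (auto simp: beta)
      have "(\<forall>\<^sub>F n in sequentially. 1 / z * real n < x n i) \<or> (\<forall>\<^sub>F n in sequentially. x n i \<le> 1 / z * real n)"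
        using z z0 by (intro scaled_root_decided[OF p _ _ S incr interlace]) auto
      then have "(\<forall>\<^sub>F n in sequentially. 1 / z < beta r n p / real n)
          \<or> (\<forall>\<^sub>F n in sequentially. beta r n p / real n \<le> 1 / z)"
      proof (elim disjE)
        assume "\<forall>\<^sub>F n in sequentially. 1 / z * real n < x n i"
        with ev have "\<forall>\<^sub>F n in sequentially. 1 / z < beta r n p / real n"
          by eventually_elim (auto simp: pos_less_divide_eq)
        then show ?thesis ..
      next
        assume "\<forall>\<^sub>F n in sequentially. x n i \<le> 1 / z * real n"
        with ev have "\<forall>\<^sub>F n in sequentially. beta r n p / real n \<le> 1 / z"
          by eventually_elim (auto simp: pos_divide_le_eq)
        then show ?thesis ..
      qed
      moreover have "1 / z \<in> {a<..<b}"
        using z z0 ab by (simp add: field_simps)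
      ultimately show "\<exists>t\<in>{a<..<b}. (\<forall>\<^sub>F n in sequentially. t < beta r n p / real n)
          \<or> (\<forall>\<^sub>F n in sequentially. beta r n p / real n \<le> t)"
        by blast
    qed
  qed
qed

end
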